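(* The family $\mathcal{D}=\{A\subseteq\omega : A\text{ is not a D-set}\}$ is a $\mathbf{\Pi}_1^1$-complete subset of $\mathcal{P}(\omega)$.
   Context: $\omega=\{0,1,2,\dots\}$. $\mathcal{P}(\omega)$ is identified with the Cantor space $2^\omega$ via characteristic functions, and so is a Polish space. For an infinite $B\subseteq\omega$ put $\Delta(B)=\{a-b : a,b\in B,\ a>b\}$. A set $A\subseteq\omega$ is a D-set if there is an infinite $B\subseteq\omega$ with $\Delta(B)\subseteq A$. Completeness: for Polish spaces $\mathcal{X},\mathcal{Y}$ and $A\subseteq\mathcal{X}$, $B\subseteq\mathcal{Y}$, $B$ is Borel reducible to $A$ if there is a Borel function $f:\mathcal{Y}\to\mathcal{X}$ with $f^{-1}[A]=B$. $A\subseteq\mathcal{X}$ is $\mathbf{\Sigma}_1^1$-complete if $A$ is analytic and for every Polish space $\mathcal{Y}$ every analytic $B\subseteq\mathcal{Y}$ is Borel reducible to $A$. $A\subseteq\mathcal{X}$ is $\mathbf{\Pi}_1^1$-complete if $\mathcal{X}\setminus A$ is $\mathbf{\Sigma}_1^1$-complete. *)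

theory Defs
  imports "HOL-Analysis.Analysis"
begin

text \<open>Polish spaces are rendered as abstract topologies \<open>'a topology\<close>, so that the
  carrier may be any subset of any type.\<close>

definition polish :: "'a topology \<Rightarrow> bool" where
  "polish X \<longleftrightarrow> completely_metrizable_space X \<and> separable_space X"

definition borel_alg :: "'a topology \<Rightarrow> 'a measure" where
  "borel_alg X = sigma (topspace X) {U. openin X U}"

text \<open>An analytic set is a continuous image of a Polish space.  HOL cannot quantify over types
  inside a definition, so the space ranges over the Polish topologies on subsets of
  \<open>nat \<Rightarrow> nat\<close>; nothing is lost, since a Polish space has at most continuum many points
  and hence is homeomorphic to one of these.\<close>

definition analytic :: "'a topology \<Rightarrow> 'a set \<Rightarrow> bool" where
  "analytic X A \<longleftrightarrow>
     (\<exists>(Z :: (nat \<Rightarrow> nat) topology) g. polish Z \<and> continuous_map Z X g \<and> g ` topspace Z = A)"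

definition borel_reducible :: "'b topology \<Rightarrow> 'b set \<Rightarrow> 'a topology \<Rightarrow> 'a set \<Rightarrow> bool" where
  "borel_reducible Y B X A \<longleftrightarrow>
     (\<exists>f. f \<in> measurable (borel_alg Y) (borel_alg X) \<and> f -` A \<inter> topspace Y = B)"

text \<open>The first argument only names the type \<open>'b\<close> on which the Polish spaces \<open>Y\<close> live.
  Completeness in the full sense, for all Polish \<open>Y\<close>, is this predicate for every type
  \<open>'b\<close>, that is, a theorem in which \<open>'b\<close> is a type variable.\<close>

definition Sigma11_complete :: "'b itself \<Rightarrow> 'a topology \<Rightarrow> 'a set \<Rightarrow> bool" where
  "Sigma11_complete _ X A \<longleftrightarrow>
     polish X \<and> analytic X A \<and>
     (\<forall>Y :: 'b topology. polish Y \<longrightarrow> (\<forall>B. analytic Y B \<longrightarrow> borel_reducible Y B X A))"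

definition Pi11_complete :: "'b itself \<Rightarrow> 'a topology \<Rightarrow> 'a set \<Rightarrow> bool" where
  "Pi11_complete T X A \<longleftrightarrow> A \<subseteq> topspace X \<and> Sigma11_complete T X (topspace X - A)"

text \<open>The Cantor topology on the power set of \<open>nat\<close>, transported along characteristic
  functions.\<close>

definition powerset_topology :: "nat set topology" where
  "powerset_topology =
     pullback_topology UNIV (\<lambda>A n. n \<in> A)
       (product_topology (\<lambda>_. discrete_topology (UNIV :: bool set)) (UNIV :: nat set))"

definition Delta :: "nat set \<Rightarrow> nat set" where
  "Delta B = {a - b | a b. a \<in> B \<and> b \<in> B \<and> a > b}"

definition D_set :: "nat set \<Rightarrow> bool" where
  "D_set A \<longleftrightarrow> (\<exists>B. infinite B \<and> Delta B \<subseteq> A)"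

end

theory Submission
  imports Defs
begin

text \<open>A graph \<open>E\<close> on the natural numbers is turned into the set of all \<open>4\<^sup>w - 4\<^sup>v\<close> with \<open>v < w\<close>
  adjacent. By the essential uniqueness of sums of three powers of 4, this set contains \<open>\<Delta>(B)\<close> for
  an infinite \<open>B\<close> if and only if \<open>E\<close> has an infinite clique. An analytic set \<open>g[Z]\<close> reduces to the
  existence of an infinite clique as follows. A vertex is a pair of a radius \<open>1/(i+1)\<close> and a point
  \<open>z\<close> of a countable dense subset of \<open>Z\<close>, and it is admissible for \<open>y\<close> if \<open>g z\<close> is within this
  radius of \<open>y\<close>. Adjacent vertices have different radii and points that are close relative to the
  radii, so an infinite clique is a Cauchy sequence, whose limit is mapped to \<open>y\<close> by \<open>g\<close>.\<close>

section \<open>Infinite cliques and D-sets\<close>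

definition infinite_clique :: "(nat \<Rightarrow> nat \<Rightarrow> bool) \<Rightarrow> nat set \<Rightarrow> bool" where
  "infinite_clique E H \<longleftrightarrow> infinite H \<and> (\<forall>v\<in>H. \<forall>w\<in>H. v < w \<longrightarrow> E v w)"

definition power4_diffs :: "(nat \<Rightarrow> nat \<Rightarrow> bool) \<Rightarrow> nat set" where
  "power4_diffs E = {4 ^ w - 4 ^ v | v w. v < w \<and> E v w}"

lemma power4_less: "a < b \<Longrightarrow> 4 * (4::nat) ^ a \<le> 4 ^ b"
  by (metis Suc_leI one_le_numeral power_Suc power_increasing)

lemma power4_cases:
  obtains "4 * (4::nat) ^ a \<le> 4 ^ b" | "a = b" | "4 * (4::nat) ^ b \<le> 4 ^ a"
  using power4_less by (metis nat_neq_iff)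

text \<open>The equation is \<open>4 ^ r - 4 ^ s = (4 ^ p - 4 ^ q) + (4 ^ u - 4 ^ v)\<close> cleared
  of subtraction. A smaller exponent costs at least a factor 4, so three smaller powers never add up
  to a larger one. Hence the leading powers \<open>4 ^ r\<close> and \<open>4 ^ u\<close> agree;
  after cancelling them the same comparison yields \<open>v = p\<close>.\<close>

lemma power4_triangle:
  fixes p q r s u v :: nat
  assumes eq: "(4::nat) ^ r + 4 ^ v + 4 ^ q = 4 ^ u + 4 ^ p + 4 ^ s"
    and "q < p" "p < r" "s < r" "v < u"
  shows "u = r \<and> v = p"
proof -
  have pos: "0 < (4::nat) ^ x" for x by simp
  note less = power4_less[OF \<open>q < p\<close>] power4_less[OF \<open>p < r\<close>]
    power4_less[OF \<open>s < r\<close>] power4_less[OF \<open>v < u\<close>]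
  have "u = r"
    using eq less pos[of p] pos[of q] pos[of r] pos[of s] pos[of u] pos[of v]
    by (cases u r rule: power4_cases) linarith+
  then have eq2: "(4::nat) ^ v + 4 ^ q = 4 ^ p + 4 ^ s"
    using eq by simp
  have "v = p"
  proof (cases v p rule: power4_cases)
    case 1
    show ?thesis
    proof (cases s p rule: power4_cases)
      case 1
      then show ?thesis
        using eq2 less \<open>4 * 4 ^ v \<le> 4 ^ p\<close> pos[of p] by linarith
    next
      case 2
      then show ?thesis
        using eq2 less \<open>4 * 4 ^ v \<le> 4 ^ p\<close> pos[of p] by simp
    next
      case 3
      then show ?thesis
        using eq2 less \<open>4 * 4 ^ v \<le> 4 ^ p\<close> pos[of p] by linarith
    qed
  next
    case 3
    show ?thesis
    \<comment> \<open>The order of \<open>s\<close> and \<open>v\<close> is not known. A large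
      \<open>s\<close> makes the right side too big, a small one makes it too small, and
      \<open>s = v\<close> would leave \<open>4 ^ q = 4 ^ p\<close>.\<close>
    proof (cases s v rule: power4_cases)
      case 1
      then show ?thesis
        using eq2 less \<open>4 * 4 ^ p \<le> 4 ^ v\<close> pos[of p] by linarith
    next
      case 2
      then have "(4::nat) ^ q = 4 ^ p"
        using eq2 by simp
      then show ?thesis
        using less pos[of p] by linarith
    next
      case 3
      then show ?thesis
        using eq2 less \<open>4 * 4 ^ p \<le> 4 ^ v\<close> pos[of p] by linarith
    qed
  qed simp
  with \<open>u = r\<close> show ?thesis by simp
qed

lemma Delta_diff: "a \<in> B \<Longrightarrow> b \<in> B \<Longrightarrow> b < a \<Longrightarrow> a - b \<in> Delta B"
  by (auto simp: Delta_def)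

text \<open>The powers \<open>4 ^ v\<close> with \<open>v\<close> in the clique form the required
  infinite set.\<close>

lemma infinite_clique_imp_D_set:
  assumes "infinite_clique E H"
  shows "D_set (power4_diffs E)"
proof -
  have "infinite ((\<lambda>v. (4::nat) ^ v) ` H)"
    using assms by (simp add: infinite_clique_def finite_image_iff inj_on_def)
  moreover have "Delta ((\<lambda>v. (4::nat) ^ v) ` H) \<subseteq> power4_diffs E"
  proof
    fix n assume "n \<in> Delta ((\<lambda>v. (4::nat) ^ v) ` H)"
    then obtain w v where "w \<in> H" "v \<in> H" "v < w" "n = 4 ^ w - 4 ^ v"
      by (auto simp: Delta_def)
    with assms show "n \<in> power4_diffs E"
      unfolding infinite_clique_def power4_diffs_def by blast
  qed
  ultimately show ?thesis
    unfolding D_set_def by blast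
qed

text \<open>Measured from the least element \<open>b0\<close> of \<open>B\<close>, every other
  element is \<open>b0 + 4 ^ p b - 4 ^ q b\<close>, and the exponents \<open>p b\<close> form the
  clique: the edge that witnesses \<open>c - b\<close> must join \<open>p b\<close> to
  \<open>p c\<close>, by \<open>power4_triangle\<close> applied to \<open>b0\<close>,
  \<open>b\<close>, \<open>c\<close>.\<close>

lemma D_set_imp_infinite_clique:
  assumes "D_set (power4_diffs E)"
  obtains H where "infinite_clique E H"
proof -
  obtain B where B: "infinite B" "Delta B \<subseteq> power4_diffs E"
    using assms by (auto simp: D_set_def)
  have edge: "\<exists>v w. v < w \<and> E v w \<and> a = b + 4 ^ w - 4 ^ v" if "a \<in> B" "b \<in> B" "b < a" for a b
  proof -
    have "a - b \<in> power4_diffs E"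
      using B(2) Delta_diff[OF that] by blast
    then obtain v w where vw: "v < w" "E v w" "a - b = 4 ^ w - 4 ^ v"
      by (auto simp: power4_diffs_def)
    then have "a = b + 4 ^ w - 4 ^ v"
      using that power4_less[OF vw(1)] by linarith
    with vw show ?thesis by blast
  qed
  define b0 where "b0 = (LEAST b. b \<in> B)"
  define B' where "B' = B - {b0}"
  have b0: "b0 \<in> B"
    unfolding b0_def using B(1) by (metis LeastI finite.emptyI ex_in_conv)
  have b0_less: "b0 < b" if "b \<in> B'" for b
    using that unfolding B'_def b0_def by (metis Diff_iff Least_le insertCI le_neq_implies_less)
  have "\<forall>b\<in>B'. \<exists>q p. q < p \<and> b = b0 + 4 ^ p - 4 ^ q"
    using edge b0 b0_less B'_def by blast
  then obtain q p where qp: "\<And>b. b \<in> B' \<Longrightarrow> q b < p b \<and> b = b0 + 4 ^ p b - 4 ^ q b"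
    by metis
  have "infinite (p ` B')"
  proof
    assume "finite (p ` B')"
    then obtain N where N: "\<And>b. b \<in> B' \<Longrightarrow> p b \<le> N"
      by (metis finite_nat_set_iff_bounded_le imageI)
    have "B' \<subseteq> {.. b0 + 4 ^ N}"
    proof
      fix b assume "b \<in> B'"
      then have "b \<le> b0 + 4 ^ p b" "(4::nat) ^ p b \<le> 4 ^ N"
        using qp[of b] N[of b] by (linarith, simp)
      then show "b \<in> {.. b0 + 4 ^ N}"
        unfolding atMost_iff by linarith
    qed
    then have "finite B'"
      using finite_subset by blast
    then show False
      using B(1) by (simp add: B'_def)
  qed
  moreover have "E (p b) (p c)" if bc: "b \<in> B'" "c \<in> B'" "p b < p c" for b c
  proof -
    have b: "q b < p b" "b = b0 + 4 ^ p b - 4 ^ q b" and c: "q c < p c" "c = b0 + 4 ^ p c - 4 ^ q c"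
      using qp bc by blast+
    note less = power4_less[OF b(1)] power4_less[OF c(1)] power4_less[OF bc(3)]
    have pos: "0 < (4::nat) ^ p b" "0 < (4::nat) ^ q b" by simp_all
    \<comment> \<open>\<open>Delta B\<close> contains only larger minus smaller, so the order of the
      exponents is first transferred to the elements.\<close>
    have "b < c"
      using b(2) c(2) less pos by linarith
    then obtain v u where uv: "v < u" "E v u" "c = b + 4 ^ u - 4 ^ v"
      using edge bc by (metis B'_def DiffD1)
    have "(4::nat) ^ p c + 4 ^ v + 4 ^ q b = 4 ^ u + 4 ^ p b + 4 ^ q c"
      using b(2) c(2) uv(3) less power4_less[OF uv(1)] by linarith
    then have "u = p c \<and> v = p b"
      using power4_triangle b(1) bc(3) c(1) uv(1) by blast
    with uv(2) show ?thesis by simp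
  qed
  ultimately have "infinite_clique E (p ` B')"
    unfolding infinite_clique_def by blast
  then show ?thesis using that by blast
qed

lemma D_set_power4_diffs: "D_set (power4_diffs E) \<longleftrightarrow> (\<exists>H. infinite_clique E H)"
  using infinite_clique_imp_D_set D_set_imp_infinite_clique by metis

section \<open>Analytic sets and infinite cliques\<close>

text \<open>For fixed vertices, \<open>y\<close> enters only through membership in two open balls.
  This openness later makes the reduction Borel.\<close>

lemma analytic_infinite_clique:
  assumes Z: "polish Z" and Y: "metrizable_space Y" and g: "continuous_map Z Y g"
  obtains E :: "'b \<Rightarrow> nat \<Rightarrow> nat \<Rightarrow> bool" where
    "\<And>v w. openin Y {y \<in> topspace Y. E y v w}"
    "\<And>y. y \<in> topspace Y \<Longrightarrow> y \<in> g ` topspace Z \<longleftrightarrow> (\<exists>H. infinite_clique (E y) H)"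
proof -
  obtain M d where M: "Metric_space M d" "Metric_space.mcomplete M d" "Z = Metric_space.mtopology M d"
    using Z by (auto simp: polish_def completely_metrizable_space_def)
  obtain N e where N: "Metric_space N e" "Y = Metric_space.mtopology N e"
    using Y by (auto simp: metrizable_space_def)
  interpret Z: Metric_space M d by (fact M(1))
  interpret Y: Metric_space N e by (fact N(1))
  have tZ: "topspace Z = M" and tY: "topspace Y = N"
    by (simp_all add: M N)
  obtain C where C: "countable C" "C \<subseteq> M" "Z.mtopology closure_of C = M"
    using Z M(3) tZ by (auto simp: polish_def separable_space_def)
  have gN: "g x \<in> N" if "x \<in> M" for x
    using continuous_map_image_subset_topspace[OF g] that tZ tY by blast
  \<comment> \<open>A vertex codes a pair of indices, one for the radius and one for the point of
    \<open>C\<close>. If \<open>C\<close> is empty, \<open>pt\<close> is meaningless; then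
    \<open>Z\<close> is empty as well, and the clause \<open>C \<noteq> {}\<close> rules out every
    edge.\<close>
  define rad where "rad v = inverse (real (Suc (fst (prod_decode v))))" for v
  define pt where "pt v = from_nat_into C (snd (prod_decode v))" for v
  define E where "E y v w \<longleftrightarrow> C \<noteq> {} \<and> rad v \<noteq> rad w \<and> d (pt v) (pt w) < rad v + rad w \<and>
      y \<in> Y.mball (g (pt v)) (rad v) \<and> y \<in> Y.mball (g (pt w)) (rad w)" for y v w
  have "openin Y {y \<in> topspace Y. E y v w}" for v w
  proof (cases "C \<noteq> {} \<and> rad v \<noteq> rad w \<and> d (pt v) (pt w) < rad v + rad w")
    case True
    then have "{y \<in> topspace Y. E y v w} = Y.mball (g (pt v)) (rad v) \<inter> Y.mball (g (pt w)) (rad w)"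
      by (auto simp: E_def tY)
    then show ?thesis
      by (simp add: N openin_Int)
  next
    case False
    then have empty: "{y \<in> topspace Y. E y v w} = {}"
      by (auto simp: E_def)
    show ?thesis
      unfolding empty by simp
  qed
  moreover have "\<exists>H. infinite_clique (E (g x)) H" if x: "x \<in> M" for x
  proof -
    have "\<exists>m. d (from_nat_into C m) x < inverse (real (Suc i)) \<and>
              e (g (from_nat_into C m)) (g x) < inverse (real (Suc i)) \<and> C \<noteq> {}" for i
    proof -
      define \<epsilon> where "\<epsilon> = inverse (real (Suc i))"
      have \<epsilon>: "0 < \<epsilon>" by (simp add: \<epsilon>_def)
      \<comment> \<open>An open neighbourhood of \<open>x\<close> by continuity of \<open>g\<close>,
        so the dense set \<open>C\<close> meets it.\<close>
      define T where "T = Z.mball x \<epsilon> \<inter> {a \<in> topspace Z. g a \<in> Y.mball (g x) \<epsilon>}"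
      have "openin Z {a \<in> topspace Z. g a \<in> Y.mball (g x) \<epsilon>}"
        using openin_continuous_map_preimage[OF g] N(2) Y.openin_mball by metis
      then have "openin Z.mtopology T"
        unfolding T_def M(3) by (intro openin_Int Z.openin_mball)
      moreover have "\<forall>T. x \<in> T \<and> openin Z.mtopology T \<longrightarrow> (\<exists>a. a \<in> C \<and> a \<in> T)"
        using C(3) x in_closure_of[of x Z.mtopology C] by simp
      moreover have "x \<in> T"
        using x \<epsilon> gN tZ by (simp add: T_def)
      ultimately obtain a where "a \<in> C" "a \<in> T"
        by metis
      then have a: "a \<in> C" "a \<in> Z.mball x \<epsilon>" "g a \<in> Y.mball (g x) \<epsilon>"
        by (simp_all only: T_def Int_iff mem_Collect_eq)
      obtain m where "from_nat_into C m = a"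
        using from_nat_into_surj[OF C(1) a(1)] by blast
      with a have "d (from_nat_into C m) x < \<epsilon> \<and> e (g (from_nat_into C m)) (g x) < \<epsilon> \<and> C \<noteq> {}"
        by (simp add: Z.commute[of _ x] Y.commute[of _ "g x"]) blast
      then show ?thesis
        unfolding \<epsilon>_def by (rule exI)
    qed
    then obtain m where m: "\<And>i. d (from_nat_into C (m i)) x < inverse (real (Suc i))"
      "\<And>i. e (g (from_nat_into C (m i))) (g x) < inverse (real (Suc i))" "C \<noteq> {}"
      by metis
    \<comment> \<open>One vertex for each radius, so distinct vertices of the clique have distinct
      radii. Their points are close enough by the triangle inequality through
      \<open>x\<close>.\<close>
    define code where "code i = prod_encode (i, m i)" for i
    have inj: "inj code"
      by (auto simp: inj_def code_def)
    have ptM: "pt v \<in> M" for v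
      using subsetD[OF C(2) from_nat_into[OF m(3)]] by (simp add: pt_def)
    have dist: "d (pt (code i)) x < rad (code i)" "e (g (pt (code i))) (g x) < rad (code i)" for i
      using m(1,2)[of i] by (simp_all add: pt_def rad_def code_def)
    have "E (g x) (code i) (code j)" if "code i < code j" for i j
    proof -
      have "rad (code i) \<noteq> rad (code j)"
        using that by (auto simp: rad_def code_def)
      moreover have "d (pt (code i)) (pt (code j)) < rad (code i) + rad (code j)"
        using dist(1)[of i] dist(1)[of j] Z.triangle[OF ptM[of "code i"] x ptM[of "code j"]]
          Z.commute[of x "pt (code j)"] by linarith
      ultimately show ?thesis
        using dist(2) gN ptM x m(3) by (simp add: E_def)
    qed
    then have "infinite_clique (E (g x)) (range code)"
      using inj by (auto simp: infinite_clique_def finite_image_iff)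
    then show ?thesis by blast
  qed
  moreover have "y \<in> g ` M" if y: "y \<in> N" and H: "infinite_clique (E y) H" for y H
  proof -
    define h where "h = enumerate H"
    have infH: "infinite H"
      using H by (simp add: infinite_clique_def)
    have "E y (h k) (h l)" if "k < l" for k l
      using H that infH enumerate_in_set enumerate_mono unfolding infinite_clique_def h_def by metis
    \<comment> \<open>The last fact concerns a single vertex; it is read off the edge from
      \<open>h k\<close> to \<open>h (Suc k)\<close>.\<close>
    then have E: "C \<noteq> {}" "\<And>k l. k < l \<Longrightarrow> rad (h k) \<noteq> rad (h l)"
      "\<And>k l. k < l \<Longrightarrow> d (pt (h k)) (pt (h l)) < rad (h k) + rad (h l)"
      "\<And>k. e (g (pt (h k))) y < rad (h k)"
      unfolding E_def by (blast, blast, blast, metis Y.in_mball lessI)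
    have ptM: "pt v \<in> M" for v
      using subsetD[OF C(2) from_nat_into[OF E(1)]] by (simp add: pt_def)
    \<comment> \<open>Distinct radii along the clique mean distinct radius indices. Each index
      occurs at most once, so the radii tend to 0.\<close>
    have "inj (\<lambda>k. fst (prod_decode (h k)))"
      using E(2) by (auto simp: rad_def intro!: linorder_injI)
    then have fin: "finite {k. fst (prod_decode (h k)) \<le> n}" for n
      using finite_vimageI[of "{..n}" "\<lambda>k. fst (prod_decode (h k))"] by (simp add: vimage_def)
    have small: "\<forall>\<^sub>F k in sequentially. rad (h k) < \<epsilon>" if "0 < \<epsilon>" for \<epsilon>
    proof -
      obtain n where n: "inverse (real (Suc n)) < \<epsilon>"
        using reals_Archimedean[OF \<open>0 < \<epsilon>\<close>] by blast
      have "\<forall>\<^sub>F k in sequentially. n < fst (prod_decode (h k))"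
        using fin[of n] by (simp add: eventually_cofinite not_less flip: cofinite_eq_sequentially)
      then show ?thesis
      proof eventually_elim
        case (elim k)
        then have "rad (h k) \<le> inverse (real (Suc n))"
          by (simp add: rad_def)
        with n show ?case by simp
      qed
    qed
    have "Z.MCauchy (pt \<circ> h)"
      unfolding Z.MCauchy_def
    proof (intro conjI allI impI)
      show "range (pt \<circ> h) \<subseteq> M"
        using ptM by auto
      fix \<epsilon> :: real assume "0 < \<epsilon>"
      then obtain n where n: "\<And>k. n \<le> k \<Longrightarrow> rad (h k) < \<epsilon> / 2"
        using small[of "\<epsilon> / 2"] by (auto simp: eventually_sequentially)
      have "d (pt (h k)) (pt (h l)) < \<epsilon>" if "n \<le> k" "n \<le> l" for k l
      proof (cases k l rule: linorder_cases)
        case less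
        then show ?thesis using E(3)[OF less] n[OF that(1)] n[OF that(2)] by linarith
      next
        case equal
        then show ?thesis using ptM \<open>0 < \<epsilon>\<close> by simp
      next
        case greater
        then show ?thesis
          using E(3)[OF greater] n[OF that(1)] n[OF that(2)] Z.commute[of "pt (h k)" "pt (h l)"] by linarith
      qed
      then show "\<exists>N. \<forall>k l. N \<le> k \<longrightarrow> N \<le> l \<longrightarrow> d ((pt \<circ> h) k) ((pt \<circ> h) l) < \<epsilon>"
        by auto
    qed
    then obtain x where x: "limitin Z.mtopology (pt \<circ> h) x sequentially"
      using M(2) Z.mcomplete_def by blast
    then have "x \<in> M"
      using Z.limitin_mspace by blast
    have "limitin Y.mtopology (g \<circ> (pt \<circ> h)) (g x) sequentially"
      using continuous_map_limit[OF g] x M N by blast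
    \<comment> \<open>Every vertex is admissible for \<open>y\<close>, so the images also converge
      to \<open>y\<close>, and uniqueness of limits gives \<open>g x = y\<close>.\<close>
    moreover have "limitin Y.mtopology (g \<circ> (pt \<circ> h)) y sequentially"
      unfolding Y.limitin_metric
    proof (intro conjI allI impI)
      fix \<epsilon> :: real assume "0 < \<epsilon>"
      from small[OF this]
      show "\<forall>\<^sub>F k in sequentially. (g \<circ> (pt \<circ> h)) k \<in> N \<and> e ((g \<circ> (pt \<circ> h)) k) y < \<epsilon>"
      proof eventually_elim
        case (elim k)
        then show ?case using E(4)[of k] gN ptM by simp
      qed
    qed (fact y)
    ultimately have "g x = y"
      using Y.limitin_metric_unique trivial_limit_sequentially by blast
    with \<open>x \<in> M\<close> show ?thesis by blast
  qed
  ultimately show ?thesis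
    using that[of E] tZ tY by blast
qed

section \<open>The power set of the natural numbers\<close>

text \<open>A continuous surjection from Baire space onto the power set. It serves three times: for
  separability, for analyticity of the D-sets, and for measurability of maps into the power
  set.\<close>

abbreviation odd_positions :: "(nat \<Rightarrow> nat) \<Rightarrow> nat set" where
  "odd_positions x \<equiv> {n. odd (x n)}"

lemma discrete_topology_eq_euclidean:
  "discrete_topology (UNIV :: 'a::discrete_topology set) = euclidean"
  by (simp add: topology_eq open_discrete flip: open_openin)

lemma continuous_on_odd: "continuous_on S (odd :: nat \<Rightarrow> bool)"
  by (rule continuous_on_subset[where s = UNIV])
    (simp_all add: continuous_on_open_vimage open_discrete)

lemma powerset_topology_eq: "powerset_topology = pullback_topology UNIV (\<lambda>A n. n \<in> A) euclidean"
  by (simp add: powerset_topology_def discrete_topology_eq_euclidean flip: euclidean_product_topology)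

lemma openin_powerset_topology:
  "openin powerset_topology U \<longleftrightarrow> (\<exists>V. open V \<and> U = {A. (\<lambda>n. n \<in> A) \<in> V})"
  by (auto simp: powerset_topology_eq openin_pullback_topology vimage_def)

lemma topspace_powerset_topology [simp]: "topspace powerset_topology = UNIV"
  by (simp add: powerset_topology_eq topspace_pullback_topology)

lemma continuous_map_odd_positions:
  "continuous_map (top_of_set S) powerset_topology odd_positions"
proof -
  have "continuous_on S (\<lambda>x :: nat \<Rightarrow> nat. \<lambda>n. odd (x n))"
    by (intro continuous_on_coordinatewise_then_product
        continuous_on_compose2[OF continuous_on_odd[of UNIV]]
        continuous_on_subset[OF continuous_on_product_coordinates]) auto
  then have "continuous_map (top_of_set S) euclidean (\<lambda>x :: nat \<Rightarrow> nat. \<lambda>n. odd (x n))"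
    by simp
  then show ?thesis
    unfolding powerset_topology_eq
    by (intro continuous_map_pullback') (auto simp: o_def)
qed

lemma completely_metrizable_space_fun_discrete:
  "completely_metrizable_space (euclidean :: ('i::countable \<Rightarrow> 'a::discrete_topology) topology)"
  unfolding euclidean_product_topology[symmetric]
  by (simp add: completely_metrizable_space_product_topology
      completely_metrizable_space_discrete_topology flip: discrete_topology_eq_euclidean)

text \<open>Supplies Polish spaces on the type over which \<open>analytic\<close> quantifies.
  Separability is obtained from second countability, which is hereditary.\<close>

lemma polish_closed_Baire:
  fixes S :: "(nat \<Rightarrow> nat) set"
  assumes "closed S"
  shows "polish (top_of_set S)"
proof -
  have "second_countable (euclidean :: (nat \<Rightarrow> nat) topology)"
    using ex_countable_basis[where 'a = "nat \<Rightarrow> nat"] unfolding second_countable_def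
    by (metis open_openin topological_basisE topological_basis_open)
  then show ?thesis
    using assms completely_metrizable_space_closedin[OF completely_metrizable_space_fun_discrete]
    by (simp add: polish_def second_countable_imp_separable_space second_countable_subtopology)
qed

text \<open>Complete metrizability is transported along characteristic functions; separability comes
  from a continuous image of Baire space.\<close>

lemma polish_powerset_topology: "polish powerset_topology"
proof -
  have "homeomorphic_maps powerset_topology (euclidean :: (nat \<Rightarrow> bool) topology)
      (\<lambda>A n. n \<in> A) (\<lambda>x. {n. x n})"
    unfolding homeomorphic_maps_def powerset_topology_eq
    using continuous_map_pullback[OF continuous_map_id, of UNIV "\<lambda>A n. n \<in> A" euclidean]
    by (auto simp: o_def intro!: continuous_map_pullback')
  then have "powerset_topology homeomorphic_space (euclidean :: (nat \<Rightarrow> bool) topology)"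
    by (auto simp: homeomorphic_space_def)
  then have "completely_metrizable_space powerset_topology"
    using homeomorphic_completely_metrizable_space completely_metrizable_space_fun_discrete
    by blast
  moreover have "separable_space powerset_topology"
  proof (rule separable_space_continuous_map_image)
    show "separable_space (top_of_set (UNIV :: (nat \<Rightarrow> nat) set))"
      using polish_closed_Baire[OF closed_UNIV] by (simp add: polish_def)
    have "A \<in> range odd_positions" for A
      by (rule image_eqI[where x = "\<lambda>n. of_bool (n \<in> A)"]) auto
    then show "odd_positions ` topspace (top_of_set UNIV) = topspace powerset_topology"
      by auto
  qed (rule continuous_map_odd_positions)
  ultimately show ?thesis
    by (simp add: polish_def)
qed

text \<open>A point \<open>x\<close> codes the infinite set of all \<open>x n div 2\<close> and the superset \<open>{n. odd (x n)}\<close> of its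
  differences.\<close>

lemma analytic_D_sets: "analytic powerset_topology {A. D_set A}"
proof -
  define S :: "(nat \<Rightarrow> nat) set" where
    "S = {x. \<forall>m n. m < n \<longrightarrow> x m div 2 < x n div 2 \<and> odd (x (x n div 2 - x m div 2))}"
  have coord: "continuous_on UNIV (\<lambda>x :: nat \<Rightarrow> nat. x n)" for n
    by (rule continuous_on_product_coordinates)
  have "closed {x :: nat \<Rightarrow> nat. x m div 2 < x n div 2 \<and> odd (x (x n div 2 - x m div 2))}" for m n
  proof -
    have "open {x :: nat \<Rightarrow> nat. P (x n)}" for P n
      using open_vimage[OF open_discrete[of "{k. P k}"] coord[of n]] by (simp add: vimage_def)
    \<comment> \<open>The position \<open>x n div 2 - x m div 2\<close> depends on \<open>x\<close>
      itself. Fixing the values \<open>i\<close> and \<open>j\<close> of \<open>x m\<close> and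
      \<open>x n\<close> makes it constant, so the complement becomes a union of sets that restrict
      three coordinates.\<close>
    then have "open {x :: nat \<Rightarrow> nat. x m = i \<and> x n = j \<and> P (x k)}" for i j k P
      by (intro open_Collect_conj)
    then have "open (\<Union>i j. {x :: nat \<Rightarrow> nat. x m = i \<and> x n = j \<and>
        \<not> (i div 2 < j div 2 \<and> odd (x (j div 2 - i div 2)))})"
      by (intro open_UN ballI)
    moreover have "(\<Union>i j. {x :: nat \<Rightarrow> nat. x m = i \<and> x n = j \<and>
        \<not> (i div 2 < j div 2 \<and> odd (x (j div 2 - i div 2)))}) =
        - {x. x m div 2 < x n div 2 \<and> odd (x (x n div 2 - x m div 2))}"
      by auto
    ultimately show ?thesis
      by (simp add: closed_def)
  qed
  then have "closed S"
    unfolding S_def by (intro closed_Collect_all closed_Collect_imp) auto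
  moreover have "odd_positions ` S = {A. D_set A}"
  proof (intro equalityI subsetI)
    fix A assume "A \<in> odd_positions ` S"
    then obtain x where x: "x \<in> S" "A = odd_positions x" by blast
    define b where "b n = x n div 2" for n
    have mono: "strict_mono b"
      using x(1) by (simp add: S_def b_def strict_mono_def)
    then have "infinite (range b)"
      by (simp add: finite_image_iff strict_mono_imp_inj_on)
    moreover have "Delta (range b) \<subseteq> A"
      using x strict_mono_less[OF mono] by (auto simp: Delta_def S_def b_def)
    ultimately show "A \<in> {A. D_set A}"
      by (auto simp: D_set_def)
  next
    fix A assume "A \<in> {A. D_set A}"
    then obtain B where B: "infinite B" "Delta B \<subseteq> A"
      by (auto simp: D_set_def)
    define x where "x n = 2 * enumerate B n + of_bool (n \<in> A)" for n
    have half: "x n div 2 = enumerate B n" and parity: "odd (x n) \<longleftrightarrow> n \<in> A" for n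
      by (simp_all add: x_def)
    have "enumerate B n - enumerate B m \<in> A" if "m < n" for m n
      using B Delta_diff enumerate_in_set enumerate_mono[OF that B(1)] by blast
    then have "x \<in> S"
      using B(1) by (simp add: S_def half parity enumerate_mono)
    moreover have "A = odd_positions x"
      by (simp add: parity)
    ultimately show "A \<in> odd_positions ` S" by blast
  qed
  ultimately show ?thesis
    unfolding analytic_def using polish_closed_Baire continuous_map_odd_positions
    by (metis topspace_euclidean_subtopology)
qed

section \<open>The reduction\<close>

lemma space_borel_alg: "space (borel_alg X) = topspace X"
  by (simp add: borel_alg_def space_measure_of_conv)

lemma openin_imp_sets_borel_alg: "openin X U \<Longrightarrow> U \<in> sets (borel_alg X)"
  unfolding borel_alg_def using openin_subset by (subst sets_measure_of) auto

text \<open>The characteristic function of \<open>f y\<close>, with values 0 and 1 in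
  \<open>nat\<close>, is measurable in each coordinate and hence Borel into Baire space; followed by
  the continuous \<open>odd_positions\<close> it gives back \<open>f\<close>.\<close>

lemma measurable_powerset_topology:
  assumes "\<And>n. {y \<in> topspace Y. n \<in> f y} \<in> sets (borel_alg Y)"
  shows "f \<in> measurable (borel_alg Y) (borel_alg powerset_topology)"
  unfolding borel_alg_def[of powerset_topology]
proof (rule measurable_measure_of)
  fix U assume "U \<in> {U. openin powerset_topology U}"
  then obtain V where V: "open V" "U = {A. (\<lambda>n. n \<in> A) \<in> V}"
    by (auto simp: openin_powerset_topology)
  define g :: "'a \<Rightarrow> nat \<Rightarrow> nat" where "g y n = of_bool (n \<in> f y)" for y n
  have "(\<lambda>y. g y n) \<in> borel_measurable (borel_alg Y)" for n
    using assms[of n] unfolding g_def of_bool_def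
    by (intro measurable_If) (auto simp: space_borel_alg)
  then have meas: "g \<in> borel_measurable (borel_alg Y)"
    by (rule measurable_coordinatewise_then_product)
  have "openin powerset_topology U"
    using V openin_powerset_topology by blast
  then have "open (odd_positions -` U)"
    using openin_continuous_map_preimage[OF continuous_map_odd_positions[of UNIV]]
    by (simp add: vimage_def)
  then have "g -` (odd_positions -` U) \<inter> space (borel_alg Y) \<in> sets (borel_alg Y)"
    using meas by (intro measurable_sets) auto
  moreover have "odd_positions (g y) = f y" for y
    by (simp add: g_def)
  ultimately show "f -` U \<inter> space (borel_alg Y) \<in> sets (borel_alg Y)"
    by (simp add: vimage_def)
qed auto

lemma borel_reducible_D_set:
  assumes Y: "polish Y" and "analytic Y B"
  shows "borel_reducible Y B powerset_topology {A. D_set A}"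
proof -
  obtain Z :: "(nat \<Rightarrow> nat) topology" and g where
    Z: "polish Z" "continuous_map Z Y g" "g ` topspace Z = B"
    using assms by (auto simp: analytic_def)
  have "metrizable_space Y"
    using Y completely_metrizable_imp_metrizable_space by (auto simp: polish_def)
  then obtain E where E: "\<And>v w. openin Y {y \<in> topspace Y. E y v w}"
    "\<And>y. y \<in> topspace Y \<Longrightarrow> y \<in> B \<longleftrightarrow> (\<exists>H. infinite_clique (E y) H)"
    using analytic_infinite_clique[OF Z(1) _ Z(2)] Z(3) by metis
  define f where "f y = power4_diffs (E y)" for y
  have "openin Y {y \<in> topspace Y. n \<in> f y}" for n
  proof -
    \<comment> \<open>Membership of a fixed \<open>n\<close> is a union of open edge conditions, so
      these sets are open and not merely Borel.\<close>
    have "{y \<in> topspace Y. n \<in> f y} =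
        (\<Union>(v, w) \<in> {(v, w). v < w \<and> n = 4 ^ w - 4 ^ v}. {y \<in> topspace Y. E y v w})"
      by (auto simp: f_def power4_diffs_def)
    then show ?thesis
      using E(1) by auto
  qed
  then have "f \<in> measurable (borel_alg Y) (borel_alg powerset_topology)"
    by (intro measurable_powerset_topology openin_imp_sets_borel_alg)
  moreover have "B \<subseteq> topspace Y"
    using Z(2,3) continuous_map_image_subset_topspace by blast
  then have "f -` {A. D_set A} \<inter> topspace Y = B"
    using E(2) by (auto simp: f_def D_set_power4_diffs)
  ultimately show ?thesis
    unfolding borel_reducible_def by blast
qed

theorem theorem2p7:
  shows "Pi11_complete TYPE('b) powerset_topology {A :: nat set. \<not> D_set A}"
proof -
  have "UNIV - {A. \<not> D_set A} = {A. D_set A}" by auto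
  then show ?thesis
    using polish_powerset_topology analytic_D_sets
    by (auto simp: Pi11_complete_def Sigma11_complete_def intro: borel_reducible_D_set)
qed

end
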